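(* Let $b>0$, $\rho>0$, $L>0$ be real numbers and define, for $z=x+\mathrm{i}y\in\mathbb{C}\setminus\{x\in\mathbb{R}:x\ge -L\}$, $$\Psi^D(z)=-\frac{\mathrm{i}b\rho}{2\pi}\Bigl((L+z)\ln(-(L+z))+(L-z)\ln(L-z)\Bigr),$$ where $\ln$ is the principal branch of the complex logarithm. Then the plastic displacement gradients of the wedge disclination dipole are obtained from $\Psi^D$: at every such $z$, $$\Theta^2_1(x,y)=\operatorname{Re}\Bigl(\frac{d\Psi^D}{dz}\Bigr),\qquad \Theta^2_2(x,y)=-\operatorname{Im}\Bigl(\frac{d\Psi^D}{dz}\Bigr),$$ where $(\Theta^2_1,\Theta^2_2)$ is the plastic displacement gradient of the dipole with terminal points $(\pm L,0)$ defined in the context.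
   Context: The non-vanishing plastic displacement gradient components (along $dx$ and $dy$) of the wedge disclination dipole with terminal points $(L,0)$ and $(-L,0)$ (equivalently, of the straight edge dislocation array with torsion $b\rho\,\delta(y)(H(x+L)-H(x-L))\,dx\wedge dy$, with $\delta$ the Dirac delta and $H$ the Heaviside function) are $$\Theta^2_1=\frac{b\rho}{2\pi}\Bigl(\arg\tfrac{y}{x+L}-\arg\tfrac{y}{x-L}\Bigr),\qquad \Theta^2_2=\frac{b\rho}{4\pi}\ln\frac{(x+L)^2+y^2}{(x-L)^2+y^2}.$$ Here $\arg(y/x)$ is notation for the function of the point $(x,y)$ that equals $0$ if $y=0$ and otherwise equals the angle in $(-\pi,\pi)$ of $(x,y)$ measured from the negative $x$-axis; explicitly, $\arctan(y/x)$ for $x<0$, $\arctan(y/x)-\pi$ for $x>0,y>0$, $\arctan(y/x)+\pi$ for $x>0,y<0$, and by continuity $-\pi/2$ (resp. $+\pi/2$) for $x=0$, $y>0$ (resp. $y<0$). *)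

theory Defs
  imports "HOL-Analysis.Analysis"
begin

text \<open>The function written \<open>arg (y/x)\<close> in the source; it depends on the point \<open>(x, y)\<close>, not only on
  the quotient. It is the angle of \<open>(x, y)\<close> measured from the negative x-axis, set to 0 on the
  whole line \<open>y = 0\<close>, the branch cut \<open>x > 0\<close> included.\<close>

definition neg_axis_arg :: "real \<Rightarrow> real \<Rightarrow> real" where
  "neg_axis_arg x y =
    (if y = 0 then 0
     else if x < 0 then arctan (y / x)
     else if x = 0 then (if y > 0 then - pi / 2 else pi / 2)
     else if y > 0 then arctan (y / x) - pi
     else arctan (y / x) + pi)"

text \<open>The non-vanishing plastic displacement gradient components (along dx and along dy) of the wedge
  disclination dipole with terminal points \<open>(L, 0)\<close> and \<open>(-L, 0)\<close>.\<close>

definition Theta21 :: "real \<Rightarrow> real \<Rightarrow> real \<Rightarrow> real \<Rightarrow> real \<Rightarrow> real" where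
  "Theta21 b \<rho> L x y =
     b * \<rho> / (2 * pi) * (neg_axis_arg (x + L) y - neg_axis_arg (x - L) y)"

definition Theta22 :: "real \<Rightarrow> real \<Rightarrow> real \<Rightarrow> real \<Rightarrow> real \<Rightarrow> real" where
  "Theta22 b \<rho> L x y =
     b * \<rho> / (4 * pi) * ln (((x + L)\<^sup>2 + y\<^sup>2) / ((x - L)\<^sup>2 + y\<^sup>2))"

definition slit_plane :: "real \<Rightarrow> complex set" where
  "slit_plane L = UNIV - {complex_of_real x | x. x \<ge> - L}"

text \<open>Defined as a total function; only its values on the open set \<open>slit_plane L\<close> are meaningful.\<close>

definition PsiD :: "real \<Rightarrow> real \<Rightarrow> real \<Rightarrow> complex \<Rightarrow> complex" where
  "PsiD b \<rho> L z =
     - (\<i> * of_real b * of_real \<rho> / (2 * of_real pi)) *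
       ((of_real L + z) * Ln (- (of_real L + z)) + (of_real L - z) * Ln (of_real L - z))"

end

theory Submission
  imports Defs
begin

text \<open>The derivative of \<open>PsiD\<close> is \<open>- \<i>\<close> times
  \<open>b * \<rho> / (2 * pi)\<close> times \<open>Ln (- (L + z)) - Ln (L - z)\<close>
  (\<open>has_field_derivative_PsiD\<close>). The factor \<open>- \<i>\<close> exchanges real and
  imaginary parts: the arguments of the logarithms give \<open>Theta21\<close>
  (\<open>Im_Ln_uminus_eq_neg_axis_arg\<close>), the logarithms of the moduli give
  \<open>Theta22\<close>.\<close>

text \<open>Negation is a half turn, so the principal argument of \<open>- w\<close> is the angle of
  \<open>w\<close> measured from the negative axis. The positive ray has to be excluded: there the
  left side is \<open>pi\<close> and the right side 0.\<close>

lemma Im_Ln_uminus_eq_neg_axis_arg: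
  assumes "w \<notin> \<real>\<^sub>\<ge>\<^sub>0"
  shows "Im (Ln (- w)) = neg_axis_arg (Re w) (Im w)"
proof -
  have "- w \<noteq> 0"
    using assms by auto
  from Im_Ln_eq[OF this] assms show ?thesis
    by (auto simp: neg_axis_arg_def complex_nonneg_Reals_iff)
qed

lemma slit_plane_iff: "z \<in> slit_plane L \<longleftrightarrow> of_real L + z \<notin> \<real>\<^sub>\<ge>\<^sub>0"
  by (auto simp: slit_plane_def complex_nonneg_Reals_iff complex_eq_iff)

text \<open>The constant terms \<open>1\<close> and \<open>- 1\<close> produced by the product rule cancel.\<close>

lemma has_field_derivative_PsiD:
  assumes "of_real L + z \<notin> \<real>\<^sub>\<ge>\<^sub>0" and "z - of_real L \<notin> \<real>\<^sub>\<ge>\<^sub>0"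
  shows "(PsiD b \<rho> L has_field_derivative
    - \<i> * of_real (b * \<rho> / (2 * pi)) * (Ln (- (of_real L + z)) - Ln (of_real L - z))) (at z)"
proof -
  have 1: "- (of_real L + z) \<notin> \<real>\<^sub>\<le>\<^sub>0"
    using assms(1) by (simp only: uminus_nonpos_Reals_iff not_False_eq_True)
  have 2: "of_real L - z \<notin> \<real>\<^sub>\<le>\<^sub>0"
    using assms(2) uminus_nonpos_Reals_iff[of "z - of_real L"] by simp
  have nz: "of_real L + z \<noteq> 0" "of_real L - z \<noteq> 0"
    using assms by auto
  \<comment> \<open>Brings the inverse coming from the first logarithm into a form that cancels
    against the factor \<open>L + z\<close>.\<close>
  have inv: "inverse (- of_real L - z) = - inverse (of_real L + z)"
    by (metis diff_conv_add_uminus inverse_minus_eq minus_add_distrib)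
  have "((\<lambda>z. (of_real L + z) * Ln (- (of_real L + z)) + (of_real L - z) * Ln (of_real L - z))
      has_field_derivative Ln (- (of_real L + z)) - Ln (of_real L - z)) (at z)"
    by (rule derivative_eq_intros refl 1 2)+ (use nz inv in simp)
  from DERIV_cmult[OF this, of "- (\<i> * of_real b * of_real \<rho> / (2 * of_real pi))"]
  show ?thesis
    unfolding PsiD_def by (simp add: mult.assoc)
qed

theorem theorem5p1:
  fixes b \<rho> L :: real and z :: complex
  assumes "b > 0" and "\<rho> > 0" and "L > 0"
    and "z \<in> slit_plane L"
  shows "PsiD b \<rho> L field_differentiable (at z)
    \<and> Theta21 b \<rho> L (Re z) (Im z) = Re (deriv (PsiD b \<rho> L) z)
    \<and> Theta22 b \<rho> L (Re z) (Im z) = - Im (deriv (PsiD b \<rho> L) z)"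
proof -
  have right: "of_real L + z \<notin> \<real>\<^sub>\<ge>\<^sub>0"
    using assms(4) by (simp add: slit_plane_iff)
  \<comment> \<open>The slit from \<open>- L\<close> contains the one from \<open>L\<close>, since
    \<open>L + z = (z - L) + 2 * L\<close>.\<close>
  with \<open>L > 0\<close> have left: "z - of_real L \<notin> \<real>\<^sub>\<ge>\<^sub>0"
    by (auto simp: complex_nonneg_Reals_iff)
  define p q where "p = Ln (- (of_real L + z))" and "q = Ln (of_real L - z)"
  have D: "(PsiD b \<rho> L has_field_derivative - \<i> * of_real (b * \<rho> / (2 * pi)) * (p - q)) (at z)"
    unfolding p_def q_def by (rule has_field_derivative_PsiD[OF right left])
  have nz: "of_real L + z \<noteq> 0" "z - of_real L \<noteq> 0"
    using right left by auto
  \<comment> \<open>Both logarithms have the form \<open>Ln (- w)\<close>, with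
    \<open>w = L + z\<close> and \<open>w = z - L\<close>.\<close>
  have Im: "Im p = neg_axis_arg (Re z + L) (Im z)" "Im q = neg_axis_arg (Re z - L) (Im z)"
    using Im_Ln_uminus_eq_neg_axis_arg[OF right] Im_Ln_uminus_eq_neg_axis_arg[OF left]
    by (simp_all add: p_def q_def add.commute)
  have pos: "(Re z + L)\<^sup>2 + (Im z)\<^sup>2 > 0" "(Re z - L)\<^sup>2 + (Im z)\<^sup>2 > 0"
    using nz by (auto simp: sum_power2_gt_zero_iff complex_eq_iff)
  have "Re p = ln (cmod (of_real L + z))"
    unfolding p_def using nz(1) by (metis Re_Ln neg_equal_0_iff_equal norm_minus_cancel)
  then have Re_p: "Re p = ln ((Re z + L)\<^sup>2 + (Im z)\<^sup>2) / 2"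
    using pos(1) by (simp add: cmod_def ln_sqrt add.commute)
  have "Re q = ln (cmod (z - of_real L))"
    using nz(2) by (simp add: q_def norm_minus_commute)
  then have Re_q: "Re q = ln ((Re z - L)\<^sup>2 + (Im z)\<^sup>2) / 2"
    using pos(2) by (simp add: cmod_def ln_sqrt)
  have ln_quot: "ln (((Re z + L)\<^sup>2 + (Im z)\<^sup>2) / ((Re z - L)\<^sup>2 + (Im z)\<^sup>2))
      = ln ((Re z + L)\<^sup>2 + (Im z)\<^sup>2) - ln ((Re z - L)\<^sup>2 + (Im z)\<^sup>2)"
    using pos by (intro ln_divide_pos)
  have "Theta21 b \<rho> L (Re z) (Im z) = Re (deriv (PsiD b \<rho> L) z)"
    by (simp add: DERIV_imp_deriv[OF D] Theta21_def Im)
  \<comment> \<open>The halves in \<open>Re_p\<close> and \<open>Re_q\<close>, due to the square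
    root in the modulus, turn \<open>2 * pi\<close> into \<open>4 * pi\<close>.\<close>
  moreover have "Theta22 b \<rho> L (Re z) (Im z) = - Im (deriv (PsiD b \<rho> L) z)"
    by (simp add: DERIV_imp_deriv[OF D] Theta22_def Re_p Re_q ln_quot right_diff_distrib)
  ultimately show ?thesis
    using D by (auto simp: field_differentiable_def)
qed

end
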